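(* Let $\mathscr{A}=\{A_1,\ldots,A_m\}$ be an irreducible set of real $d\times d$ matrices with $\rho=\rho(\mathscr{A})>0$, and let $\|\cdot\|_0$ be an extremal norm for $\mathscr{A}$ on $\mathbb{R}^d$. Then the sequence of norms defined by \[ \|x\|_{n+1}=\frac{1}{\rho}\max_{i}\|A_ix\|_n,\qquad x\in\mathbb{R}^d,\ n=0,1,\ldots, \] monotonically decreases (that is, $\|x\|_{n+1}\le\|x\|_n$ for all $x\in\mathbb{R}^d$ and all $n\ge 0$) and converges pointwise on $\mathbb{R}^d$ to some Barabanov norm of $\mathscr{A}$.
   Context: A set $\mathscr{A}$ of real $d\times d$ matrices is irreducible if the matrices from $\mathscr{A}$ have no common invariant subspace other than $\{0\}$ and $\mathbb{R}^d$. The joint spectral radius is $\rho(\mathscr{A})=\limsup_{n\to\infty}\max_{\sigma\in\{1,\ldots,m\}^n}\|A_{\sigma_n}\cdots A_{\sigma_1}\|^{1/n}$; it does not depend on the norm. A norm $\|\cdot\|$ on $\mathbb{R}^d$ is extremal for $\mathscr{A}$ if $\max_i\|A_ix\|\le\rho(\mathscr{A})\|x\|$ for all $x\in\mathbb{R}^d$. It is a Barabanov norm of $\mathscr{A}$ if $\max_i\|A_ix\|=\rho(\mathscr{A})\|x\|$ for all $x\in\mathbb{R}^d$. *)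

theory Defs
  imports "HOL-Analysis.Analysis"
begin

definition irreducible_matrices :: "(real ^ 'd ^ 'd) set \<Rightarrow> bool" where
  "irreducible_matrices \<A> \<longleftrightarrow>
     (\<forall>V. subspace V \<and> (\<forall>M\<in>\<A>. \<forall>x\<in>V. M *v x \<in> V) \<longrightarrow> V = {0} \<or> V = UNIV)"

(* A finite set of matrices is given as a family A 1, ..., A m; values outside {1..m} are irrelevant. *)

primrec mat_word :: "(nat \<Rightarrow> real ^ 'd ^ 'd) \<Rightarrow> (nat \<Rightarrow> nat) \<Rightarrow> nat \<Rightarrow> real ^ 'd ^ 'd" where
  "mat_word A \<sigma> 0 = mat 1"
| "mat_word A \<sigma> (Suc n) = A (\<sigma> (Suc n)) ** mat_word A \<sigma> n"

(* The limsup is taken in ereal because it needs a complete lattice. For m > 0 the sequence lies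
   between 0 and the maximum of 1 and the norms of the A i, so the limsup is finite and
   real_of_ereal loses nothing. The norm used is the operator norm of the Euclidean norm;
   the value is the same for any other norm. *)
definition joint_spectral_radius :: "(nat \<Rightarrow> real ^ 'd ^ 'd) \<Rightarrow> nat \<Rightarrow> real" where
  "joint_spectral_radius A m =
     real_of_ereal (limsup (\<lambda>n. ereal
       (Max ((\<lambda>\<sigma>. root n (onorm ((*v) (mat_word A \<sigma> n)))) ` ({1..n} \<rightarrow>\<^sub>E {1..m})))))"

definition is_norm :: "('a::real_vector \<Rightarrow> real) \<Rightarrow> bool" where
  "is_norm N \<longleftrightarrow>
     (\<forall>x. 0 \<le> N x) \<and> (\<forall>x. N x = 0 \<longleftrightarrow> x = 0) \<and>
     (\<forall>c x. N (c *\<^sub>R x) = \<bar>c\<bar> * N x) \<and> (\<forall>x y. N (x + y) \<le> N x + N y)"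

definition extremal_norm :: "(nat \<Rightarrow> real ^ 'd ^ 'd) \<Rightarrow> nat \<Rightarrow> (real ^ 'd \<Rightarrow> real) \<Rightarrow> bool" where
  "extremal_norm A m N \<longleftrightarrow> is_norm N \<and>
     (\<forall>x. Max ((\<lambda>i. N (A i *v x)) ` {1..m}) \<le> joint_spectral_radius A m * N x)"

definition barabanov_norm :: "(nat \<Rightarrow> real ^ 'd ^ 'd) \<Rightarrow> nat \<Rightarrow> (real ^ 'd \<Rightarrow> real) \<Rightarrow> bool" where
  "barabanov_norm A m N \<longleftrightarrow> is_norm N \<and>
     (\<forall>x. Max ((\<lambda>i. N (A i *v x)) ` {1..m}) = joint_spectral_radius A m * N x)"

end

theory Submission
  imports Defs
begin

text \<open>
  The recursion is monotone and homogeneous, so extremality of the initial norm propagates to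
  \<open>N (Suc n) \<le> N n\<close>, and the limit \<open>B\<close> is a seminorm with
  \<open>\<rho> * B x = max\<^sub>i B (A\<^sub>i x)\<close>. Its kernel is a common invariant subspace, hence \<open>{0}\<close> or
  everything. In the latter case finite dimension makes the convergence to 0 uniform, so that
  \<open>N k \<le> N 0 / 2\<close> for some \<open>k \<ge> 1\<close>; iterating, words of length \<open>L\<close> have norm
  at most \<open>C * (\<rho> * root k (1/2)) ^ L\<close>, which contradicts the value of the joint spectral
  radius. Hence \<open>B\<close> is a norm, and so is every \<open>N n \<ge> B\<close>.
\<close>

section \<open>Seminorms and norms on Euclidean spaces\<close>

text \<open>Definiteness of the later iterates follows only at the very end, from that of their
  limit, so the construction runs on this weaker notion.\<close>

definition is_seminorm :: "('a::real_vector \<Rightarrow> real) \<Rightarrow> bool" where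
  "is_seminorm N \<longleftrightarrow>
     (\<forall>x. 0 \<le> N x) \<and> (\<forall>c x. N (c *\<^sub>R x) = \<bar>c\<bar> * N x) \<and> (\<forall>x y. N (x + y) \<le> N x + N y)"

lemma is_seminormI:
  assumes "\<And>x. 0 \<le> N x" "\<And>c x. N (c *\<^sub>R x) = \<bar>c\<bar> * N x" "\<And>x y. N (x + y) \<le> N x + N y"
  shows "is_seminorm N"
  using assms by (simp add: is_seminorm_def)

lemma is_seminormD:
  assumes "is_seminorm N"
  shows "0 \<le> N x" "N (c *\<^sub>R x) = \<bar>c\<bar> * N x" "N (x + y) \<le> N x + N y"
  using assms by (simp_all add: is_seminorm_def)

lemma is_seminorm_zero: "is_seminorm N \<Longrightarrow> N 0 = 0"
  using is_seminormD(2)[of N 0 0] by simp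

lemma is_norm_iff_seminorm: "is_norm N \<longleftrightarrow> is_seminorm N \<and> (\<forall>x. N x = 0 \<longrightarrow> x = 0)"
  by (auto simp: is_norm_def is_seminorm_zero is_seminorm_def dest: spec[of _ 0])

lemma is_seminorm_sum_le:
  assumes "is_seminorm N"
  shows "N (sum f S) \<le> (\<Sum>i\<in>S. N (f i))"
proof (induction S rule: infinite_finite_induct)
  case (insert i S)
  then show ?case
    using is_seminormD(3)[OF assms, of "f i" "sum f S"] by simp
qed (simp_all add: is_seminorm_zero[OF assms])

text \<open>Expand \<open>x\<close> in the standard basis. The explicit constant matters: along a
  sequence of seminorms it tends to 0 as soon as the values at the finitely many basis vectors do,
  which turns pointwise into uniform convergence.\<close>

lemma is_seminorm_le_Basis:
  fixes N :: "'a::euclidean_space \<Rightarrow> real"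
  assumes "is_seminorm N"
  shows "N x \<le> (\<Sum>b\<in>Basis. N b) * norm x"
proof -
  have "N x = N (\<Sum>b\<in>Basis. (x \<bullet> b) *\<^sub>R b)"
    by (simp add: euclidean_representation)
  also have "\<dots> \<le> (\<Sum>b\<in>Basis. N ((x \<bullet> b) *\<^sub>R b))"
    by (rule is_seminorm_sum_le[OF assms])
  also have "\<dots> \<le> (\<Sum>b\<in>Basis. N b * norm x)"
  proof (rule sum_mono)
    fix b :: 'a assume "b \<in> Basis"
    then have "\<bar>x \<bullet> b\<bar> * N b \<le> norm x * N b"
      by (intro mult_right_mono Basis_le_norm is_seminormD[OF assms])
    then show "N ((x \<bullet> b) *\<^sub>R b) \<le> N b * norm x"
      by (simp add: is_seminormD(2)[OF assms] mult.commute)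
  qed
  finally show ?thesis by (simp add: sum_distrib_right)
qed

lemma is_seminorm_continuous:
  fixes N :: "'a::euclidean_space \<Rightarrow> real"
  assumes "is_seminorm N"
  shows "continuous_on S N"
proof -
  let ?K = "\<Sum>b\<in>Basis. N b"
  have *: "N x - N y \<le> ?K * norm (x - y)" for x y
    using is_seminormD(3)[OF assms, of "x - y" y] is_seminorm_le_Basis[OF assms, of "x - y"]
    by simp
  have "?K-lipschitz_on S N"
  proof (rule lipschitz_onI)
    show "dist (N x) (N y) \<le> ?K * dist x y" for x y
      using *[of x y] *[of y x] by (simp add: dist_norm norm_minus_commute abs_le_iff)
  qed (simp add: sum_nonneg is_seminormD(1)[OF assms])
  then show ?thesis by (rule lipschitz_on_continuous_on)
qed

text \<open>By compactness \<open>N\<close> attains its minimum on the unit sphere; definiteness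
  makes it positive, and homogeneity extends the bound to all vectors.\<close>

lemma is_norm_lower_bound:
  fixes N :: "'a::euclidean_space \<Rightarrow> real"
  assumes "is_norm N"
  obtains c where "c > 0" "\<And>x. c * norm x \<le> N x"
proof -
  have semi: "is_seminorm N" and definite: "\<And>x. N x = 0 \<Longrightarrow> x = 0"
    using assms by (auto simp: is_norm_iff_seminorm)
  obtain z where z: "z \<in> sphere 0 1" "\<And>y. y \<in> sphere 0 1 \<Longrightarrow> N z \<le> N y"
    using continuous_attains_inf[of "sphere 0 1" N] is_seminorm_continuous[OF semi] by auto
  show thesis
  proof (rule that)
    show "N z > 0"
      using z(1) definite[of z] is_seminormD(1)[OF semi, of z] by fastforce
    fix x
    show "N z * norm x \<le> N x"
    proof (cases "x = 0")
      case False
      then have "N z \<le> N (inverse (norm x) *\<^sub>R x)"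
        by (intro z(2)) simp
      then show ?thesis
        using False by (simp add: is_seminormD(2)[OF semi] field_simps)
    qed (simp add: is_seminormD(1)[OF semi])
  qed
qed

section \<open>Maxima over finite families\<close>

lemma is_seminorm_Max_linear:
  assumes "is_seminorm N" "finite I" "I \<noteq> {}" "\<And>i. i \<in> I \<Longrightarrow> linear (f i)" "0 \<le> c"
  shows "is_seminorm (\<lambda>x. c * Max ((\<lambda>i. N (f i x)) ` I))"
proof (rule is_seminormI)
  let ?M = "\<lambda>x. Max ((\<lambda>i. N (f i x)) ` I)"
  have ge: "N (f i x) \<le> ?M x" if "i \<in> I" for i x
    using that assms(2) by simp
  obtain i0 where "i0 \<in> I" using assms(3) by blast
  then have "0 \<le> ?M x" for x
    using ge is_seminormD(1)[OF assms(1)] order_trans by blast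
  then show "0 \<le> c * ?M x" for x
    using assms(5) by simp
  show "c * ?M (a *\<^sub>R x) = \<bar>a\<bar> * (c * ?M x)" for a x
  proof -
    have "(\<lambda>i. N (f i (a *\<^sub>R x))) ` I = (\<lambda>t. \<bar>a\<bar> * t) ` (\<lambda>i. N (f i x)) ` I"
      unfolding image_image
      by (intro image_cong refl) (simp add: linear_cmul[OF assms(4)] is_seminormD(2)[OF assms(1)])
    moreover have "mono (\<lambda>t. \<bar>a\<bar> * t)"
      by (intro monoI mult_left_mono) auto
    ultimately have "?M (a *\<^sub>R x) = \<bar>a\<bar> * ?M x"
      using mono_Max_commute[of "\<lambda>t. \<bar>a\<bar> * t" "(\<lambda>i. N (f i x)) ` I"] assms(2,3) by simp
    then show ?thesis by simp
  qed
  show "c * ?M (x + y) \<le> c * ?M x + c * ?M y" for x y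
  proof -
    have "N (f i (x + y)) \<le> ?M x + ?M y" if "i \<in> I" for i
      using is_seminormD(3)[OF assms(1), of "f i x" "f i y"] ge[OF that, of x] ge[OF that, of y]
      by (simp add: linear_add[OF assms(4)[OF that]])
    then have "?M (x + y) \<le> ?M x + ?M y"
      using assms(2,3) by simp
    then show ?thesis
      using assms(5) by (metis distrib_left mult_left_mono)
  qed
qed

lemma tendsto_Max_image:
  fixes f :: "'i \<Rightarrow> 'b \<Rightarrow> real"
  assumes "finite I" "I \<noteq> {}" "\<And>i. i \<in> I \<Longrightarrow> (f i \<longlongrightarrow> l i) F"
  shows "((\<lambda>n. Max ((\<lambda>i. f i n) ` I)) \<longlongrightarrow> Max (l ` I)) F"
  using assms
proof (induction I rule: finite_ne_induct)
  case (insert i I)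
  then show ?case by (simp add: tendsto_max)
qed simp

section \<open>Growth rate of matrix words\<close>

text \<open>The constant \<open>C\<close> does not affect the growth rate, since
  \<open>root L C\<close> tends to 1. The case \<open>L = 0\<close> may be left out because the
  limsup ignores it.\<close>

lemma joint_spectral_radius_le:
  assumes "m \<ge> 1" "C > 0" "r \<ge> 0"
    and bound: "\<And>L \<sigma>. L \<ge> 1 \<Longrightarrow> \<sigma> \<in> {1..L} \<rightarrow>\<^sub>E {1..m} \<Longrightarrow> onorm ((*v) (mat_word A \<sigma> L)) \<le> C * r ^ L"
  shows "joint_spectral_radius A m \<le> r"
proof -
  let ?S = "\<lambda>L. (\<lambda>\<sigma>. root L (onorm ((*v) (mat_word A \<sigma> L)))) ` ({1..L} \<rightarrow>\<^sub>E {1..m})"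
  have le: "Max (?S L) \<le> root L C * r" if "L \<ge> 1" for L
  proof (subst Max_le_iff)
    show "finite (?S L)" by (intro finite_imageI finite_PiE) auto
    show "?S L \<noteq> {}" using assms(1) by (simp add: PiE_eq_empty_iff)
    have "root L (onorm ((*v) (mat_word A \<sigma> L))) \<le> root L C * r"
      if "\<sigma> \<in> {1..L} \<rightarrow>\<^sub>E {1..m}" for \<sigma>
    proof -
      have "root L (onorm ((*v) (mat_word A \<sigma> L))) \<le> root L (C * r ^ L)"
        using \<open>L \<ge> 1\<close> bound[OF \<open>L \<ge> 1\<close> that] by simp
      also have "\<dots> = root L C * r"
        using \<open>L \<ge> 1\<close> assms(3) by (simp add: real_root_mult real_root_power_cancel)
      finally show ?thesis .
    qed
    then show "\<forall>a\<in>?S L. a \<le> root L C * r" by blast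
  qed
  have "(\<lambda>L. root L C * r) \<longlonglongrightarrow> 1 * r"
    by (intro tendsto_intros LIMSEQ_root_const assms)
  then have "limsup (\<lambda>L. ereal (root L C * r)) = ereal r"
    by (intro lim_imp_Limsup) auto
  moreover have "limsup (\<lambda>L. ereal (Max (?S L))) \<le> limsup (\<lambda>L. ereal (root L C * r))"
    using le by (intro Limsup_mono) (auto simp: eventually_sequentially intro!: exI[of _ 1])
  ultimately have "limsup (\<lambda>L. ereal (Max (?S L))) \<le> ereal r" by simp
  \<comment> \<open>\<open>real_of_ereal\<close> sends an infinite limsup to 0: the value
    \<infinity> is excluded by the bound, and for -\<infinity> the claim is
    \<open>0 \<le> r\<close>.\<close>
  then show ?thesis
    unfolding joint_spectral_radius_def
    using assms(3) by (cases "limsup (\<lambda>L. ereal (Max (?S L)))") auto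
qed

section \<open>Kernels and limits of seminorms\<close>

lemma subspace_is_seminorm_kernel:
  assumes "is_seminorm N"
  shows "subspace {x. N x = 0}"
proof (rule subspaceI)
  show "x + y \<in> {x. N x = 0}" if "x \<in> {x. N x = 0}" "y \<in> {x. N x = 0}" for x y
    using that is_seminormD(1)[OF assms, of "x + y"] is_seminormD(3)[OF assms, of x y] by simp
qed (simp_all add: is_seminorm_zero[OF assms] is_seminormD(2)[OF assms])

text \<open>The fixed-point equation makes the kernel of \<open>B\<close> invariant under every
  \<open>A i\<close>, and irreducibility then leaves only the trivial kernel.\<close>

lemma seminorm_fixed_point_is_norm:
  fixes A :: "nat \<Rightarrow> real ^ 'd ^ 'd"
  assumes "is_seminorm B" "irreducible_matrices (A ` {1..m})" "\<exists>x. B x \<noteq> 0"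
    and fixed: "\<And>x. Max ((\<lambda>i. B (A i *v x)) ` {1..m}) = \<rho> * B x"
  shows "is_norm B"
proof -
  have "B (A i *v x) = 0" if "B x = 0" "i \<in> {1..m}" for i x
  proof -
    have "B (A i *v x) \<le> Max ((\<lambda>i. B (A i *v x)) ` {1..m})"
      using that(2) by (intro Max_ge) auto
    then show ?thesis
      using that(1) fixed[of x] is_seminormD(1)[OF assms(1), of "A i *v x"] by simp
  qed
  then have "{x. B x = 0} = {0} \<or> {x. B x = 0} = UNIV"
    using assms(2) subspace_is_seminorm_kernel[OF assms(1)]
    unfolding irreducible_matrices_def by auto
  then show ?thesis
    using assms(1,3) by (auto simp: is_norm_iff_seminorm)
qed

lemma is_seminorm_tendsto:
  assumes "\<And>n. is_seminorm (N n)" "\<And>x. (\<lambda>n. N n x) \<longlonglongrightarrow> B x"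
  shows "is_seminorm B"
proof (rule is_seminormI)
  note semi = is_seminormD[OF assms(1)]
  show "0 \<le> B x" for x
    using LIMSEQ_le_const[OF assms(2)] semi(1) by blast
  show "B (c *\<^sub>R x) = \<bar>c\<bar> * B x" for c x
  proof (rule LIMSEQ_unique)
    show "(\<lambda>n. N n (c *\<^sub>R x)) \<longlonglongrightarrow> \<bar>c\<bar> * B x"
      unfolding semi(2) by (intro tendsto_intros assms)
  qed (rule assms)
  show "B (x + y) \<le> B x + B y" for x y
    using LIMSEQ_le[OF assms(2) tendsto_add[OF assms(2) assms(2)]] semi(3) by blast
qed

section \<open>Uniform decay against the joint spectral radius\<close>

text \<open>Halving every \<open>k\<close> steps is geometric decay with ratio
  \<open>q = root k (1/2) < 1\<close>, so words grow at rate at most \<open>\<rho> * q\<close>. Here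
  \<open>M\<close> plays the role of the initial norm.\<close>

lemma uniform_decay_imp_joint_spectral_radius_less:
  fixes A :: "nat \<Rightarrow> real ^ 'd ^ 'd"
  assumes "m \<ge> 1" "\<rho> > 0" "is_norm M" "k \<ge> 1"
    and words: "\<And>L \<sigma> x. \<sigma> \<in> {1..L} \<rightarrow>\<^sub>E {1..m} \<Longrightarrow> M (mat_word A \<sigma> L *v x) \<le> \<rho> ^ L * N L x"
    and "\<And>n x. N n x \<le> M x"
    and half: "\<And>n x. N (n + k) x \<le> N n x / 2"
  shows "joint_spectral_radius A m < \<rho>"
proof -
  have semi: "is_seminorm M" using assms(3) by (simp add: is_norm_iff_seminorm)
  define q where "q = root k (1/2)"
  have q: "0 < q" "q < 1" "q ^ k = 1/2"
    using assms(4) by (simp_all add: q_def)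
  \<comment> \<open>The factor 2 pays for an incomplete block of fewer than \<open>k\<close> steps,
    where \<open>q ^ L\<close> is still at least \<open>q ^ k = 1/2\<close>.\<close>
  have decay: "N L x \<le> 2 * q ^ L * M x" for L x
  proof (induction L rule: less_induct)
    case (less L)
    show ?case
    proof (cases "L < k")
      case True
      then have "1/2 \<le> q ^ L"
        using power_decreasing[of L k q] q by simp
      then have "1 * M x \<le> 2 * q ^ L * M x"
        by (intro mult_right_mono is_seminormD[OF semi]) simp
      then show ?thesis using assms(6)[of L x] by simp
    next
      case False
      then obtain L' where L': "L = L' + k" by (metis add.commute le_Suc_ex not_less)
      then have "N L x \<le> N L' x / 2" using half by simp
      also have "\<dots> \<le> 2 * q ^ L' * M x / 2"
        using less[of L'] L' assms(4) by simp
      also have "\<dots> = 2 * q ^ L * M x"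
        using L' q(3) by (simp add: power_add)
      finally show ?thesis .
    qed
  qed
  obtain c where c: "c > 0" "\<And>x. c * norm x \<le> M x"
    using is_norm_lower_bound[OF assms(3)] by blast
  let ?K = "\<Sum>b\<in>Basis. M b"
  have K: "0 \<le> ?K" by (simp add: sum_nonneg is_seminormD(1)[OF semi])
  have "joint_spectral_radius A m \<le> \<rho> * q"
  \<comment> \<open>\<open>c\<close> and \<open>?K + 1\<close> compare \<open>M\<close> with the
    Euclidean norm from below and above; the summand 1 makes the constant positive at once.\<close>
  proof (rule joint_spectral_radius_le[where C = "2 * (?K + 1) / c"])
    show "onorm ((*v) (mat_word A \<sigma> L)) \<le> 2 * (?K + 1) / c * (\<rho> * q) ^ L"
      if "\<sigma> \<in> {1..L} \<rightarrow>\<^sub>E {1..m}" for L \<sigma>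
    proof (rule onorm_le)
      fix x
      have "c * norm (mat_word A \<sigma> L *v x) \<le> M (mat_word A \<sigma> L *v x)" by (rule c)
      also have "\<dots> \<le> \<rho> ^ L * N L x" by (rule words[OF that])
      also have "\<dots> \<le> \<rho> ^ L * (2 * q ^ L * ((?K + 1) * norm x))"
      proof -
        have "M x \<le> (?K + 1) * norm x"
          using is_seminorm_le_Basis[OF semi, of x] by (simp add: algebra_simps add_increasing)
        then have "2 * q ^ L * M x \<le> 2 * q ^ L * ((?K + 1) * norm x)"
          using q by (intro mult_left_mono) auto
        then show ?thesis
          using assms(2) decay[of L x] by (intro mult_left_mono) auto
      qed
      finally show "norm (mat_word A \<sigma> L *v x) \<le> 2 * (?K + 1) / c * (\<rho> * q) ^ L * norm x"
        using c(1) by (simp add: field_simps power_mult_distrib)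
    qed
  qed (use assms(1,2) q(1) c(1) K in auto)
  also have "\<dots> < \<rho>" using assms(2) q by simp
  finally show ?thesis .
qed

section \<open>Convergence of the iterates to a Barabanov norm\<close>

theorem lemma4p4:
  fixes A :: "nat \<Rightarrow> real ^ 'd ^ 'd" and m :: nat and \<rho> :: real
    and N :: "nat \<Rightarrow> real ^ 'd \<Rightarrow> real"
  assumes "m \<ge> 1"
    and "irreducible_matrices (A ` {1..m})"
    and "\<rho> = joint_spectral_radius A m" and "\<rho> > 0"
    and "extremal_norm A m (N 0)"
    and "\<And>n x. N (Suc n) x = 1 / \<rho> * Max ((\<lambda>i. N n (A i *v x)) ` {1..m})"
  shows "(\<forall>n. is_norm (N n)) \<and>
         (\<forall>n x. N (Suc n) x \<le> N n x) \<and>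
         (\<exists>B. barabanov_norm A m B \<and> (\<forall>x. (\<lambda>n. N n x) \<longlonglongrightarrow> B x))"
proof -
  note rec = assms(6)
  have ne: "{1..m} \<noteq> {}" using assms(1) by simp
  have norm0: "is_norm (N 0)"
    and ext: "\<And>x. Max ((\<lambda>i. N 0 (A i *v x)) ` {1..m}) \<le> \<rho> * N 0 x"
    using assms(3,5) by (auto simp: extremal_norm_def)
  have semi: "is_seminorm (N n)" for n
  proof (induction n)
    case (Suc n)
    then have "is_seminorm (\<lambda>x. 1 / \<rho> * Max ((\<lambda>i. N n (A i *v x)) ` {1..m}))"
      using assms(4) ne by (intro is_seminorm_Max_linear) auto
    then show ?case by (simp add: rec[abs_def])
  qed (use norm0 in \<open>simp add: is_norm_iff_seminorm\<close>)
  have step_ge: "N n (A i *v x) \<le> \<rho> * N (Suc n) x" if "i \<in> {1..m}" for n i x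
    using that assms(4) by (simp add: rec)
  have step_le: "N (Suc n) x \<le> t" if "\<And>i. i \<in> {1..m} \<Longrightarrow> N n (A i *v x) \<le> \<rho> * t" for n x t
  proof -
    have "Max ((\<lambda>i. N n (A i *v x)) ` {1..m}) \<le> \<rho> * t"
      using that ne by (subst Max_le_iff) auto
    then show ?thesis using assms(4) by (simp add: rec field_simps)
  qed
  \<comment> \<open>The base case is extremality. In the step, \<open>N (Suc n) (A i *v x) \<le> N n
    (A i *v x) \<le> \<rho> * N (Suc n) x\<close> for each \<open>i\<close>.\<close>
  have dec: "N (Suc n) x \<le> N n x" for n x
  proof (induction n arbitrary: x)
    case 0
    show ?case using ext[of x] assms(4) by (simp add: rec field_simps)
  next
    case (Suc n)
    show ?case
      by (rule step_le) (rule order_trans[OF Suc step_ge])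
  qed
  have anti: "N n x \<le> N k x" if "k \<le> n" for n k x
    using lift_Suc_antimono_le[of "\<lambda>n. N n x"] dec that by blast
  define B where "B x = lim (\<lambda>n. N n x)" for x
  have lim: "(\<lambda>n. N n x) \<longlonglongrightarrow> B x" for x
  proof -
    have "convergent (\<lambda>n. N n x)"
    proof (rule Bseq_monoseq_convergent)
      show "monoseq (\<lambda>n. N n x)" using anti by (auto simp: monoseq_def)
      show "Bseq (\<lambda>n. N n x)"
        by (rule BseqI'[of _ "N 0 x"]) (simp add: is_seminormD(1)[OF semi] anti)
    qed
    then show ?thesis by (simp add: B_def convergent_LIMSEQ_iff)
  qed
  have semiB: "is_seminorm B" using semi lim by (rule is_seminorm_tendsto)
  \<comment> \<open>Pass to the limit on both sides of the recursion; a maximum over finitely many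
    indices commutes with limits.\<close>
  have fixed: "Max ((\<lambda>i. B (A i *v x)) ` {1..m}) = \<rho> * B x" for x
  proof -
    have "(\<lambda>n. 1 / \<rho> * Max ((\<lambda>i. N n (A i *v x)) ` {1..m}))
            \<longlonglongrightarrow> 1 / \<rho> * Max ((\<lambda>i. B (A i *v x)) ` {1..m})"
      using ne lim by (intro tendsto_mult tendsto_const tendsto_Max_image) auto
    moreover have "(\<lambda>n. N (Suc n) x) \<longlonglongrightarrow> B x"
      using lim by (rule LIMSEQ_Suc)
    ultimately have "B x = 1 / \<rho> * Max ((\<lambda>i. B (A i *v x)) ` {1..m})"
      unfolding rec by (rule LIMSEQ_unique[rotated])
    then show ?thesis using assms(4) by simp
  qed
  \<comment> \<open>Each letter costs a factor \<open>\<rho>\<close> and raises the index by one, so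
    \<open>j\<close> must vary in the induction. The premise is pointwise because a member of
    \<open>{1..Suc L} \<rightarrow>\<^sub>E {1..m}\<close> is not one of
    \<open>{1..L} \<rightarrow>\<^sub>E {1..m}\<close>.\<close>
  have word_le: "N j (mat_word A \<sigma> L *v x) \<le> \<rho> ^ L * N (j + L) x"
    if "\<And>l. l \<in> {1..L} \<Longrightarrow> \<sigma> l \<in> {1..m}" for j L \<sigma> x
    using that
  proof (induction L arbitrary: j)
    case (Suc L)
    have "N j (mat_word A \<sigma> (Suc L) *v x) \<le> \<rho> * N (Suc j) (mat_word A \<sigma> L *v x)"
      using step_ge[OF Suc.prems[of "Suc L"]] by (simp add: matrix_vector_mul_assoc[symmetric])
    also have "\<dots> \<le> \<rho> * (\<rho> ^ L * N (Suc j + L) x)"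
      using assms(4) Suc.prems by (intro mult_left_mono Suc.IH) auto
    finally show ?case by (simp add: mult.assoc)
  qed simp
  have "\<exists>x. B x \<noteq> 0"
  proof (rule ccontr)
    assume "\<not> ?thesis"
    then have to0: "(\<lambda>n. N n x) \<longlonglongrightarrow> 0" for x using lim[of x] by simp
    obtain c where c: "c > 0" "\<And>x. c * norm x \<le> N 0 x"
      using is_norm_lower_bound[OF norm0] by blast
    have "(\<lambda>n. \<Sum>b\<in>Basis. N n b) \<longlonglongrightarrow> 0"
      using to0 by (intro tendsto_null_sum)
    \<comment> \<open>The threshold \<open>c / 2\<close> gives
      \<open>N k x \<le> c / 2 * norm x \<le> N 0 x / 2\<close>, and \<open>1 \<le> n\<close> makes
      the \<open>k\<close>-th root meaningful.\<close>
    then have "\<forall>\<^sub>F n in sequentially. (\<Sum>b\<in>Basis. N n b) < c / 2 \<and> 1 \<le> n"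
      using c(1) by (intro eventually_conj order_tendstoD(2) eventually_ge_at_top) auto
    then obtain k where k: "(\<Sum>b\<in>Basis. N k b) < c / 2" "1 \<le> k"
      using eventually_happens'[OF sequentially_bot] by blast
    \<comment> \<open>The choice of \<open>k\<close> settles \<open>n = 0\<close>; the recursion,
      being monotone and homogeneous, carries the inequality from \<open>n\<close> to
      \<open>Suc n\<close>.\<close>
    have half: "N (n + k) x \<le> N n x / 2" for n x
    proof (induction n arbitrary: x)
      case 0
      have "N k x \<le> (\<Sum>b\<in>Basis. N k b) * norm x"
        by (rule is_seminorm_le_Basis[OF semi])
      also have "\<dots> \<le> c / 2 * norm x" using k(1) by (intro mult_right_mono) auto
      also have "\<dots> \<le> N 0 x / 2" using c(2)[of x] by simp
      finally show ?case by simp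
    next
      case (Suc n)
      show ?case
        unfolding add_Suc
      proof (rule step_le)
        fix i assume "i \<in> {1..m}"
        then show "N (n + k) (A i *v x) \<le> \<rho> * (N (Suc n) x / 2)"
          using Suc[of "A i *v x"] step_ge[of i n x] by simp
      qed
    qed
    have "joint_spectral_radius A m < \<rho>"
    proof (rule uniform_decay_imp_joint_spectral_radius_less[OF assms(1,4) norm0 k(2)])
      show "N 0 (mat_word A \<sigma> L *v x) \<le> \<rho> ^ L * N L x" if "\<sigma> \<in> {1..L} \<rightarrow>\<^sub>E {1..m}" for L \<sigma> x
        using word_le[of L \<sigma> 0 x] that PiE_mem[OF that] by simp
    qed (use anti half in auto)
    then show False using assms(3) by simp
  qed
  with semiB assms(2) have normB: "is_norm B"
    using fixed by (rule seminorm_fixed_point_is_norm)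
  have "is_norm (N n)" for n
  proof -
    have "x = 0" if "N n x = 0" for x
    proof -
      \<comment> \<open>A decreasing sequence stays above its limit, so each iterate inherits
        definiteness from \<open>B\<close>.\<close>
      have "B x \<le> N n x"
        using LIMSEQ_le_const2[OF lim] anti by blast
      then show ?thesis
        using that normB is_seminormD(1)[OF semiB, of x] by (auto simp: is_norm_iff_seminorm)
    qed
    then show ?thesis using semi by (simp add: is_norm_iff_seminorm)
  qed
  moreover have "barabanov_norm A m B"
    using normB fixed assms(3) by (simp add: barabanov_norm_def)
  ultimately show ?thesis using dec lim by blast
qed

end
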